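(* Let $n\ge 0$ and $d\ge 1$ be integers, let $\gamma_{n/d}=\sqrt{1-\frac{n^2}{(n+d)^2}}$, and consider the bivariate polynomial $$f(x,y)=d(x^2-1)y^2+2nxy-(2n+d).$$ Let $s>\gamma_{n/d}$ and $t>0$ be real numbers with $f(s,t)\ge 0$. Then $$\mathcal{G}_{C_d^{(n+1)}}(s)\le t .$$
   Context: For real $a>0$, the Gegenbauer polynomials $C_m^{(a)}(x)$ are defined by $\sum_{m\ge 0}C_m^{(a)}(x)t^m=(1-2xt+t^2)^{-a}$. For a nonconstant polynomial $p$, its Cauchy transform is $\mathcal{G}_p(x)=\frac{1}{\deg p}\,\frac{p'(x)}{p(x)}$. *)

theory Defs
  imports "HOL-Complex_Analysis.Complex_Analysis"
begin

text \<open>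
  The generating function \<open>(1 - 2 x t + t\<^sup>2)\<^sup>-\<^sup>a\<close> is read as a formal power series in \<open>t\<close>
  over the ring of polynomials in \<open>x\<close>: the binomial series of \<open>(1 + w)\<^sup>-\<^sup>a\<close> composed with
  \<open>w = - 2 x t + t\<^sup>2\<close>. The lemma below confirms that it is also the power series expansion of
  the function.
\<close>

definition gegenbauer_gen_fun :: "real \<Rightarrow> real poly fps" where
  "gegenbauer_gen_fun a =
     Abs_fps (\<lambda>k. [:(- a) gchoose k:]) oo (fps_const [:0, - 2:] * fps_X + fps_X ^ 2)"

definition gegenbauer :: "real \<Rightarrow> nat \<Rightarrow> real poly" where
  "gegenbauer a m = fps_nth (gegenbauer_gen_fun a) m"

lemma gegenbauer_sums:
  "\<forall>\<^sub>F t in nhds 0. (\<lambda>m. poly (gegenbauer a m) x * t ^ m) sums (1 - 2 * x * t + t ^ 2) powr (- a)"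
proof -
  define h where "h = (\<lambda>p. complex_of_real (poly p x))"
  define P :: "real poly fps" where "P = fps_const [:0, - 2:] * fps_X + fps_X ^ 2"
  define G :: "complex fps" where "G = fps_const (of_real (- 2 * x)) * fps_X + fps_X ^ 2"
  define F where "F = (\<lambda>t::complex. (1 + (of_real (- 2 * x) * t + t ^ 2)) powr of_real (- a))"
  define B where "B = fps_binomial (complex_of_real (- a)) oo G"
  have h_sum: "h (sum f A) = (\<Sum>i\<in>A. h (f i))" for f :: "nat \<Rightarrow> real poly" and A
    by (simp add: h_def poly_sum)
  have h_mult: "h (p * q) = h p * h q" for p q
    by (simp add: h_def)
  have "h (fps_nth P k) = fps_nth G k" for k
    by (simp add: P_def G_def h_def fps_X_power_nth fps_X_nth)
  hence pow: "h (fps_nth (P ^ i) k) = fps_nth (G ^ i) k" for i k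
    by (induction i arbitrary: k) (simp_all add: h_def fps_mult_nth poly_sum)
  have coeff: "of_real (poly (gegenbauer a m) x) = fps_nth B m" for m
  proof -
    have "of_real (poly (gegenbauer a m) x)
        = h (\<Sum>i=0..m. [:(- a) gchoose i:] * fps_nth (P ^ i) m)"
      by (simp add: gegenbauer_def gegenbauer_gen_fun_def P_def h_def fps_compose_nth)
    also have "\<dots> = (\<Sum>i=0..m. h [:(- a) gchoose i:] * fps_nth (G ^ i) m)"
      by (simp only: h_sum h_mult pow)
    also have "\<dots> = fps_nth B m"
      by (simp add: B_def h_def fps_compose_nth gbinomial_prod_rev)
    finally show ?thesis .
  qed
  have "((\<lambda>w. (1 + w) powr of_real (- a)) \<circ> (\<lambda>t. of_real (- 2 * x) * t + t ^ 2))
          has_fps_expansion B"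
    unfolding B_def
  proof (rule has_fps_expansion_compose)
    show "(\<lambda>t. of_real (- 2 * x) * t + t ^ 2) has_fps_expansion G"
      unfolding G_def by (intro fps_expansion_intros)
  qed (simp_all add: G_def has_fps_expansion_binomial_complex)
  hence F: "F has_fps_expansion B"
    by (simp add: F_def o_def)
  have ev_complex: "\<forall>\<^sub>F t in nhds 0. t \<in> eball 0 (fps_conv_radius B) \<and> eval_fps B t = F t"
    using F by (intro eventually_conj eventually_nhds_in_open)
               (auto simp: has_fps_expansion_def zero_ereal_def)
  have lim: "filterlim complex_of_real (nhds 0) (nhds 0)"
    by (rule tendsto_eq_intros refl filterlim_ident | simp)+
  have ev: "\<forall>\<^sub>F t in nhds 0. complex_of_real t \<in> eball 0 (fps_conv_radius B) \<and>
                             eval_fps B (of_real t) = F (of_real t)"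
    by (rule eventually_compose_filterlim[OF ev_complex lim])
  have "filterlim (\<lambda>t. 1 - 2 * x * t + t ^ 2) (nhds 1) (nhds 0)"
    by (rule tendsto_eq_intros refl filterlim_ident | simp)+
  hence "\<forall>\<^sub>F t in nhds 0. 1 - 2 * x * t + t ^ 2 > 0"
    by (rule order_tendstoD) simp
  with ev show ?thesis
  proof eventually_elim
    case (elim t)
    have "(\<lambda>m. fps_nth B m * of_real t ^ m) sums F (of_real t)"
      using sums_eval_fps[of "complex_of_real t" B] elim by simp
    moreover have "F (of_real t) = of_real ((1 - 2 * x * t + t ^ 2) powr (- a))"
    proof -
      have "F (of_real t) = of_real (1 - 2 * x * t + t ^ 2) powr of_real (- a)"
        by (simp add: F_def algebra_simps)
      also have "\<dots> = of_real ((1 - 2 * x * t + t ^ 2) powr (- a))"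
        using elim by (subst powr_of_real) simp_all
      finally show ?thesis .
    qed
    ultimately have "(\<lambda>m. complex_of_real (poly (gegenbauer a m) x * t ^ m)) sums
                       of_real ((1 - 2 * x * t + t ^ 2) powr (- a))"
      by (simp add: coeff)
    thus ?case
      by (simp only: sums_of_real_iff)
  qed
qed

definition cauchy_transform :: "real poly \<Rightarrow> real \<Rightarrow> real" where
  "cauchy_transform p x = 1 / real (degree p) * (poly (pderiv p) x / poly p x)"

definition gamma_ratio :: "nat \<Rightarrow> nat \<Rightarrow> real" where
  "gamma_ratio n d = sqrt (1 - real n ^ 2 / (real n + real d) ^ 2)"

definition bivariate_f :: "nat \<Rightarrow> nat \<Rightarrow> real \<Rightarrow> real \<Rightarrow> real" where
  "bivariate_f n d x y =
     real d * (x ^ 2 - 1) * y ^ 2 + 2 * real n * x * y - (2 * real n + real d)"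

end

theory Submission
  imports Defs
begin

text \<open>
  Up to a constant, \<open>C_d^{(n+1)}\<close> is the \<open>n\<close>-th derivative of the Chebyshev polynomial
  \<open>U_{n+d}\<close>, so by Rolle it has \<open>d\<close> distinct roots in \<open>(-1, 1)\<close>, and these are symmetric about 0.
  Put \<open>S = \<Sum> 1 / (x - r)\<close> and \<open>Q = \<Sum> 1 / (x - r)\<^sup>2\<close> over the roots \<open>r\<close>, so that the Cauchy
  transform is \<open>g = S / d\<close>. The Gegenbauer differential equation, written as a Riccati equation,
  gives \<open>d f(x, g) = (x\<^sup>2 - 1) Q - 3 x S + 2 d\<close>; averaging the summands for \<open>r\<close> and \<open>-r\<close> turns this
  into \<open>- \<Sum> (x\<^sup>2 + r\<^sup>2 - 2 r\<^sup>4) / (x\<^sup>2 - r\<^sup>2)\<^sup>2\<close>, which is negative to the right of all roots.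

  For \<open>s \<ge> 1\<close> the claim follows since \<open>f(s, y)\<close> increases in \<open>y > 0\<close>. For \<open>\<gamma> < s < 1\<close> the parabola
  \<open>f(x, -)\<close> is positive at its vertex \<open>n x / (d (1 - x\<^sup>2))\<close>, so \<open>g\<close> cannot cross the vertex on
  \<open>(\<gamma>, 1)\<close>. Near 1 it lies below the vertex, whereas it tends to infinity at the largest root. Hence
  that root is less than \<open>s\<close>, and \<open>g(s)\<close> lies on the increasing branch of the parabola.
\<close>

section \<open>Generating function coefficients: derivative in \<open>x\<close> and the case
  \<open>a = 1\<close>\<close>

lemma gegenbauer_eq_sum:
  "gegenbauer a m = (\<Sum>i=0..m. smult ((- a) gchoose i)
     (fps_nth ((fps_const [:0, - 2:] * fps_X + fps_X ^ 2) ^ i) m))"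
  by (simp add: gegenbauer_def gegenbauer_gen_fun_def fps_compose_nth)

text \<open>Partial derivative in the polynomial variable \<open>x\<close>; \<open>fps_deriv\<close>
  would differentiate in the series variable \<open>t\<close>.\<close>

definition fps_pderiv :: "real poly fps \<Rightarrow> real poly fps" where
  "fps_pderiv F = Abs_fps (\<lambda>m. pderiv (fps_nth F m))"

lemma fps_pderiv_mult: "fps_pderiv (F * G) = F * fps_pderiv G + fps_pderiv F * G"
  by (rule fps_ext) (simp add: fps_pderiv_def fps_mult_nth higher_pderiv_sum[of 1, simplified]
      pderiv_mult sum.distrib mult.commute[of "fps_nth G i" for i])

lemma fps_pderiv_power:
  "fps_pderiv (F ^ Suc i) = of_nat (Suc i) * (F ^ i * fps_pderiv F)"
proof (induction i)
  case (Suc i)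
  show ?case
    by (subst power_Suc, subst fps_pderiv_mult, subst Suc.IH) (simp add: algebra_simps)
qed simp

text \<open>With \<open>w = - 2 x t + t\<^sup>2\<close>, the \<open>x\<close>-derivative of
  \<open>(1 + w)\<^sup>-\<^sup>a\<close> is \<open>2 a t\<close> times the power with exponent
  \<open>- (a + 1)\<close>, and the factor \<open>t\<close> shifts the index by one. The chain rule
  is applied termwise to the binomial series.\<close>

lemma pderiv_gegenbauer:
  "pderiv (gegenbauer a (Suc m)) = smult (2 * a) (gegenbauer (a + 1) m)"
proof -
  define P :: "real poly fps" where "P = fps_const [:0, - 2:] * fps_X + fps_X ^ 2"
  have P': "fps_pderiv P = fps_const [:- 2:] * fps_X"
    by (rule fps_ext) (simp add: P_def fps_pderiv_def fps_X_nth fps_X_power_nth pderiv_pCons)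
  have P_pow: "pderiv (fps_nth (P ^ Suc i) (Suc m)) = smult (- 2 * real (Suc i)) (fps_nth (P ^ i) m)"
    for i
  proof -
    have "fps_pderiv (P ^ Suc i) = fps_const (of_nat (Suc i) * [:- 2:]) * (P ^ i * fps_X)"
      by (simp only: fps_pderiv_power P' fps_of_nat [symmetric] fps_const_mult [symmetric] ac_simps)
    hence "fps_nth (fps_pderiv (P ^ Suc i)) (Suc m) = (of_nat (Suc i) * [:- 2:]) * fps_nth (P ^ i) m"
      by (simp only: fps_mult_left_const_nth fps_mult_fps_X_commute [symmetric]) simp
    also have "of_nat (Suc i) * [:- 2:] = ([:- 2 * real (Suc i):] :: real poly)"
      by (simp add: of_nat_poly)
    finally show ?thesis
      by (simp add: fps_pderiv_def)
  qed
  have "pderiv (gegenbauer a (Suc m)) =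
      (\<Sum>i=0..Suc m. smult ((- a) gchoose i) (pderiv (fps_nth (P ^ i) (Suc m))))"
    by (simp only: gegenbauer_eq_sum P_def higher_pderiv_sum[of 1, simplified] pderiv_smult)
  \<comment> \<open>The term \<open>i = 0\<close> drops out: \<open>P ^ 0 = 1\<close> has
    coefficient 0 at \<open>Suc m\<close>.\<close>
  also have "\<dots> = (\<Sum>i=0..m. smult ((- a) gchoose Suc i) (pderiv (fps_nth (P ^ Suc i) (Suc m))))"
    by (subst sum.atLeast0_atMost_Suc_shift) (simp del: power_Suc)
  also have "\<dots> = (\<Sum>i=0..m. smult (2 * a) (smult ((- (a + 1)) gchoose i) (fps_nth (P ^ i) m)))"
  proof (rule sum.cong [OF refl])
    fix i
    have "real (Suc i) * ((- a) gchoose Suc i) = - a * ((- (a + 1)) gchoose i)"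
      using gbinomial_absorption'[of "Suc i" "- a"] by (simp add: field_simps minus_diff_commute)
    hence "((- a) gchoose Suc i) * (- 2 * real (Suc i)) = 2 * a * ((- (a + 1)) gchoose i)"
      by (simp only: mult.commute mult.left_commute mult_minus_left mult_minus_right)
    thus "smult ((- a) gchoose Suc i) (pderiv (fps_nth (P ^ Suc i) (Suc m))) =
        smult (2 * a) (smult ((- (a + 1)) gchoose i) (fps_nth (P ^ i) m))"
      by (simp only: P_pow smult_smult)
  qed
  also have "\<dots> = smult (2 * a) (gegenbauer (a + 1) m)"
    using sum_distrib_left[of "[:2 * a:]" _ "{0..m}"] by (simp add: gegenbauer_eq_sum P_def)
  finally show ?thesis .
qed

text \<open>For \<open>a = 1\<close> the generating function is
  \<open>1 / (1 - 2 x t + t\<^sup>2)\<close>. Multiplying by the denominator and comparing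
  coefficients yields the recurrence of the Chebyshev polynomials \<open>U_m\<close>.\<close>

lemma gegenbauer_1_rec:
  "gegenbauer 1 0 = 1"
  "gegenbauer 1 (Suc 0) = [:0, 2:]"
  "gegenbauer 1 (Suc (Suc m)) = [:0, 2:] * gegenbauer 1 (Suc m) - gegenbauer 1 m"
proof -
  define P :: "real poly fps" where "P = fps_const [:0, - 2:] * fps_X + fps_X ^ 2"
  define B :: "real poly fps" where "B = Abs_fps (\<lambda>k. [:(- 1) gchoose k:])"
  have [simp]: "(- 1 :: real) gchoose k = (- 1) ^ k" for k
    by (simp add: gbinomial_minus binomial_gbinomial [symmetric])
  have "B * (1 + fps_X) = 1"
  proof (rule fps_ext)
    fix m show "fps_nth (B * (1 + fps_X)) m = fps_nth 1 m"
      by (cases m) (simp_all add: B_def distrib_left one_pCons)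
  qed
  hence "(B * (1 + fps_X)) oo P = 1 oo P" by simp
  moreover have "fps_nth P 0 = 0" by (simp add: P_def)
  ultimately have *: "(B oo P) * (1 + P) = 1"
    by (simp add: fps_compose_mult_distrib fps_compose_add_distrib)
  have g: "gegenbauer 1 m = fps_nth (B oo P) m" for m
    by (simp add: gegenbauer_def gegenbauer_gen_fun_def B_def P_def)
  have **: "(B oo P) + (fps_const [:0, - 2:] * ((B oo P) * fps_X) + (B oo P) * fps_X * fps_X) = 1"
    using * by (simp add: P_def algebra_simps power2_eq_square)
  have nth: "fps_nth (B oo P) m + ([:0, - 2:] * fps_nth ((B oo P) * fps_X) m
      + fps_nth ((B oo P) * fps_X * fps_X) m) = fps_nth 1 m" for m
    using arg_cong[OF **, of "\<lambda>F. fps_nth F m"] by simp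
  show "gegenbauer 1 0 = 1" using nth[of 0] by (simp add: g)
  thus "gegenbauer 1 (Suc 0) = [:0, 2:]" using nth[of 1]
    by (simp add: g one_pCons eq_neg_iff_add_eq_0 [symmetric])
  show "gegenbauer 1 (Suc (Suc m)) = [:0, 2:] * gegenbauer 1 (Suc m) - gegenbauer 1 m"
    using nth[of "Suc (Suc m)"] by (simp add: g eq_neg_iff_add_eq_0 [symmetric])
qed

section \<open>Rolle's theorem, logarithmic derivatives and factorization over distinct
  roots\<close>

text \<open>Rolle between consecutive points of \<open>A\<close>. Since \<open>B\<close> stays
  strictly below \<open>Max A\<close>, the point found beyond \<open>Max A\<close> in the induction
  step is new; the same bounds later confine the roots to (-1, 1).\<close>

lemma rolle_roots:
  fixes p :: "real poly"
  assumes "finite A" "A \<noteq> {}" "\<forall>x\<in>A. poly p x = 0"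
  shows "\<exists>B. finite B \<and> B \<subseteq> {Min A<..<Max A} \<and> Suc (card B) = card A \<and>
           (\<forall>x\<in>B. poly (pderiv p) x = 0)"
  using assms
proof (induction rule: finite_linorder_max_induct)
  case (insert b A)
  show ?case
  proof (cases "A = {}")
    case True
    thus ?thesis by (intro exI[of _ "{}"]) simp
  next
    case False
    then obtain B where B: "finite B" "B \<subseteq> {Min A<..<Max A}" "Suc (card B) = card A"
      "\<forall>x\<in>B. poly (pderiv p) x = 0"
      using insert by auto
    have MA: "Max A \<in> A" "Min A \<le> Max A"
      using insert.hyps False by (auto intro: Max_in Min_le)
    hence "Max A < b" using insert.hyps by auto
    moreover have "poly p (Max A) = 0" "poly p b = 0" using insert.prems MA by auto
    ultimately obtain z where z: "z > Max A" "z < b" "poly (pderiv p) z = 0"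
      using poly_MVT[of "Max A" b p] by auto
    have M: "Max (insert b A) = b" "Min (insert b A) = Min A"
      using insert.hyps False MA \<open>Max A < b\<close> less_le_trans[OF \<open>Max A < b\<close>]
      by (auto simp: max_absorb1 min_absorb2 less_imp_le)
    have "z \<notin> B" using B z by auto
    moreover have "b \<notin> A" using insert.hyps by auto
    moreover have "insert z B \<subseteq> {Min A<..<b}"
      using B(2) z MA \<open>Max A < b\<close> by fastforce
    ultimately show ?thesis
      using B z insert.hyps(1) unfolding M by (intro exI[of _ "insert z B"]) auto
  qed
qed simp

text \<open>Logarithmic differentiation: \<open>p' / p = S\<close> and
  \<open>p'' / p = S\<^sup>2 + S'\<close>, where \<open>S' = - Q\<close>.\<close>

lemma prod_linear_derivs:
  fixes x :: real
  assumes "finite R" "x \<notin> R"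
  defines "p \<equiv> \<Prod>r\<in>R. [:- r, 1:]"
  shows "poly (pderiv p) x = poly p x * (\<Sum>r\<in>R. 1 / (x - r))"
    and "poly (pderiv (pderiv p)) x =
      poly p x * ((\<Sum>r\<in>R. 1 / (x - r))\<^sup>2 - (\<Sum>r\<in>R. 1 / (x - r)\<^sup>2))"
proof -
  have "poly (pderiv p) x = poly p x * (\<Sum>r\<in>R. 1 / (x - r)) \<and> poly (pderiv (pderiv p)) x =
      poly p x * ((\<Sum>r\<in>R. 1 / (x - r))\<^sup>2 - (\<Sum>r\<in>R. 1 / (x - r)\<^sup>2))"
    using assms(1,2) unfolding p_def
  proof (induction rule: finite_induct)
    case (insert r R)
    define q where "q = (\<Prod>r\<in>R. [:- r, 1:])"
    define S where "S = (\<Sum>r\<in>R. 1 / (x - r))"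
    define Q where "Q = (\<Sum>r\<in>R. 1 / (x - r)\<^sup>2)"
    have q: "poly (pderiv q) x = poly q x * S" "poly (pderiv (pderiv q)) x = poly q x * (S\<^sup>2 - Q)"
      using insert by (auto simp: q_def S_def Q_def)
    have p: "(\<Prod>r\<in>insert r R. [:- r, 1:]) = [:- r, 1:] * q"
      using insert.hyps by (simp add: q_def)
    have S: "(\<Sum>r\<in>insert r R. 1 / (x - r)) = 1 / (x - r) + S"
      "(\<Sum>r\<in>insert r R. 1 / (x - r)\<^sup>2) = 1 / (x - r)\<^sup>2 + Q"
      using insert.hyps by (simp_all add: S_def Q_def)
    \<comment> \<open>Naming the reciprocal leaves a polynomial identity modulo
      \<open>(x - r) * u = 1\<close>, which \<open>algebra\<close> can settle.\<close>
    define u where "u = 1 / (x - r)"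
    have u: "(x - r) * u = 1" "1 / (x - r)\<^sup>2 = u\<^sup>2"
      using insert.prems by (auto simp: u_def power_one_over)
    have d: "pderiv ([:- r, 1:] * q) = q + [:- r, 1:] * pderiv q" for q :: "real poly"
      by (simp only: pderiv_mult) (simp add: pderiv_pCons)
    have e: "poly ([:- r, 1:] * q) x = (x - r) * poly q x" for q
      by (simp add: algebra_simps)
    show ?case
      unfolding p S u(2) e d pderiv_add poly_add q u_def [symmetric]
      using u(1) by algebra
  qed simp
  thus "poly (pderiv p) x = poly p x * (\<Sum>r\<in>R. 1 / (x - r))"
    "poly (pderiv (pderiv p)) x =
      poly p x * ((\<Sum>r\<in>R. 1 / (x - r))\<^sup>2 - (\<Sum>r\<in>R. 1 / (x - r)\<^sup>2))" by auto
qed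

text \<open>Both sides have the same leading term, so a nonzero difference would have degree below
  \<open>degree p\<close> and still vanish at the \<open>degree p\<close> points of
  \<open>R\<close>.\<close>

lemma poly_eq_smult_prod_roots:
  fixes p :: "'a::{idom} poly"
  assumes "R \<subseteq> {x. poly p x = 0}" "finite R" "card R = degree p"
  shows "p = smult (lead_coeff p) (\<Prod>r\<in>R. [:- r, 1:])"
proof (rule ccontr)
  define q where "q = smult (lead_coeff p) (\<Prod>r\<in>R. [:- r, 1:])"
  assume "p \<noteq> smult (lead_coeff p) (\<Prod>r\<in>R. [:- r, 1:])"
  hence ne: "p - q \<noteq> 0" by (simp add: q_def)
  have deg: "degree (\<Prod>r\<in>R. [:- r, 1:]) = degree p"
    using assms by (subst degree_prod_eq_sum_degree) auto
  have "lead_coeff (\<Prod>r\<in>R. [:- r, 1:]) = 1"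
    by (simp add: lead_coeff_prod)
  hence "coeff q (degree p) = lead_coeff p" using deg by (simp add: q_def)
  hence "coeff (p - q) (degree p) = 0" by simp
  moreover have "degree (p - q) \<le> degree p"
    using deg by (intro degree_diff_le) (auto simp: q_def)
  ultimately have lt: "degree (p - q) < degree p"
    using ne by (metis eq_zero_or_degree_less leading_coeff_0_iff order_le_less)
  have "R \<subseteq> {x. poly (p - q) x = 0}"
    using assms by (auto simp: q_def poly_prod)
  hence "card R \<le> card {x. poly (p - q) x = 0}"
    by (intro card_mono poly_roots_finite ne)
  also have "\<dots> \<le> degree (p - q)" by (rule card_poly_roots_bound[OF ne])
  finally show False using lt assms by simp
qed

section \<open>Roots in (-1, 1), starting from the Chebyshev case\<close>

lemma degree_gegenbauer_1: "degree (gegenbauer 1 m) \<le> m"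
proof (induction m rule: induct_nat_012)
  case (ge2 m)
  have "degree ([:0, 2:] * gegenbauer 1 (Suc m)) \<le> Suc (Suc m)"
    using degree_mult_le[of "[:0, 2:]" "gegenbauer 1 (Suc m)"] ge2 by simp
  thus ?case
    unfolding gegenbauer_1_rec(3) using ge2 by (intro degree_diff_le) auto
qed (simp_all add: gegenbauer_1_rec)

text \<open>The trigonometric form of \<open>U_m\<close>, multiplied out so that it also covers
  angles with \<open>sin \<theta> = 0\<close>.\<close>

lemma sin_gegenbauer_1: "sin \<theta> * poly (gegenbauer 1 m) (cos \<theta>) = sin ((real m + 1) * \<theta>)"
proof (induction m rule: induct_nat_012)
  case (ge2 m)
  have "sin \<theta> * poly (gegenbauer 1 (Suc (Suc m))) (cos \<theta>) =
      2 * cos \<theta> * (sin \<theta> * poly (gegenbauer 1 (Suc m)) (cos \<theta>)) - sin \<theta> * poly (gegenbauer 1 m) (cos \<theta>)"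
    by (simp add: gegenbauer_1_rec(3) algebra_simps)
  also have "\<dots> = 2 * cos \<theta> * sin ((real m + 2) * \<theta>) - sin ((real m + 2) * \<theta> - \<theta>)"
    using ge2 by (simp add: algebra_simps)
  also have "\<dots> = sin ((real m + 2) * \<theta> + \<theta>)"
    by (simp add: sin_add sin_diff)
  also have "\<dots> = sin ((real (Suc (Suc m)) + 1) * \<theta>)"
    by (simp add: algebra_simps)
  finally show ?case .
qed (simp_all add: gegenbauer_1_rec sin_double)

text \<open>Distinct roots are counted, so all roots are simple and lie in (-1, 1). The zero
  polynomial must be excluded by hand, because its infinite root set has \<open>card\<close> 0,
  which is also its degree.\<close>

definition rooted_in_unit_interval :: "real poly \<Rightarrow> bool" where
  "rooted_in_unit_interval p \<longleftrightarrow> p \<noteq> 0 \<and> card {x. \<bar>x\<bar> < 1 \<and> poly p x = 0} = degree p"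

text \<open>An upper bound on the degree suffices: \<open>degree p \<le> card A\<close>, and
  \<open>card A\<close> is at most the number of roots, hence at most \<open>degree p\<close>. The
  exact degree comes out as well.\<close>

lemma rooted_in_unit_intervalI:
  assumes "p \<noteq> 0" "finite A" "\<And>x. x \<in> A \<Longrightarrow> \<bar>x\<bar> < 1 \<and> poly p x = 0" "degree p \<le> card A"
  shows "rooted_in_unit_interval p" "card A = degree p"
proof -
  let ?R = "{x. \<bar>x\<bar> < 1 \<and> poly p x = 0}"
  have fin: "finite {x. poly p x = 0}" by (rule poly_roots_finite[OF assms(1)])
  have "card A \<le> card ?R"
    using assms(3) by (intro card_mono finite_subset[OF _ fin]) auto
  moreover have "card ?R \<le> card {x. poly p x = 0}"
    by (intro card_mono fin) auto
  moreover have "card {x. poly p x = 0} \<le> degree p"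
    by (rule card_poly_roots_bound[OF assms(1)])
  ultimately show "rooted_in_unit_interval p" "card A = degree p"
    using assms by (auto simp: rooted_in_unit_interval_def)
qed

lemma rooted_in_unit_interval_pderiv:
  assumes "rooted_in_unit_interval p" "degree p > 0"
  shows "rooted_in_unit_interval (pderiv p)"
proof -
  define A where "A = {x. \<bar>x\<bar> < 1 \<and> poly p x = 0}"
  have card: "card A = degree p" and "p \<noteq> 0"
    using assms by (auto simp: rooted_in_unit_interval_def A_def)
  hence A: "finite A" "A \<noteq> {}" using assms(2) by (auto intro: card_ge_0_finite)
  moreover have "\<forall>x\<in>A. poly p x = 0" by (simp add: A_def)
  ultimately obtain B where B: "finite B" "B \<subseteq> {Min A<..<Max A}" "Suc (card B) = card A"
    "\<forall>x\<in>B. poly (pderiv p) x = 0"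
    using rolle_roots[of A p] by blast
  have "Min A \<in> A" "Max A \<in> A" using A by (auto intro: Min_in Max_in)
  moreover have "- 1 < x \<and> x < 1" if "x \<in> A" for x using that by (auto simp: A_def)
  ultimately have "Min A > -1" "Max A < 1" by blast+
  hence "\<bar>x\<bar> < 1" if "x \<in> B" for x using B(2) that by fastforce
  thus ?thesis
    using B(1,3,4) card assms(2)
    by (intro rooted_in_unit_intervalI(1)[of _ B]) (auto simp: pderiv_eq_0_iff degree_pderiv)
qed

text \<open>The roots are \<open>cos (k * pi / (m + 1))\<close> for \<open>k\<close> from 1 to
  \<open>m\<close>, distinct because \<open>cos\<close> is injective between 0 and
  \<open>pi\<close>.\<close>

lemma gegenbauer_1_roots:
  "rooted_in_unit_interval (gegenbauer 1 m)" "degree (gegenbauer 1 m) = m"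
proof -
  define f where "f = (\<lambda>k. cos (real k * pi / (real m + 1)))"
  have ang: "0 < real k * pi / (real m + 1)" "real k * pi / (real m + 1) < pi"
    if "k \<in> {1..m}" for k
  proof -
    have "real k * pi < (real m + 1) * pi" using that by (intro mult_strict_right_mono) auto
    thus "real k * pi / (real m + 1) < pi" by (simp add: pos_divide_less_eq mult.commute)
    show "0 < real k * pi / (real m + 1)" using that by simp
  qed
  have inj: "inj_on f {1..m}"
  proof (rule inj_onI)
    fix j k assume jk: "j \<in> {1..m}" "k \<in> {1..m}" "f j = f k"
    have "real j * pi / (real m + 1) = real k * pi / (real m + 1)"
      by (rule cos_inj_pi) (use ang[OF jk(1)] ang[OF jk(2)] jk(3) in \<open>simp_all add: f_def\<close>)
    thus "j = k" by simp
  qed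
  have root: "\<bar>x\<bar> < 1 \<and> poly (gegenbauer 1 m) x = 0" if "x \<in> f ` {1..m}" for x
  proof -
    obtain k where k: "k \<in> {1..m}" "x = f k" using \<open>x \<in> f ` {1..m}\<close> by auto
    define \<theta> where "\<theta> = real k * pi / (real m + 1)"
    have sin: "sin \<theta> > 0"
      using ang[OF k(1)] by (simp add: sin_gt_zero \<theta>_def)
    have "sin \<theta> ^ 2 + cos \<theta> ^ 2 = 1" by simp
    hence "cos \<theta> ^ 2 < 1" using sin by (smt (verit) zero_less_power)
    hence "\<bar>cos \<theta>\<bar> < 1" by (simp add: abs_square_less_1)
    moreover have "(real m + 1) * \<theta> = real k * pi" by (simp add: \<theta>_def)
    hence "sin \<theta> * poly (gegenbauer 1 m) (cos \<theta>) = 0"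
      by (simp add: sin_gegenbauer_1)
    ultimately show ?thesis using sin by (simp add: k(2) f_def \<theta>_def)
  qed
  have "gegenbauer 1 m \<noteq> 0"
  proof
    assume "gegenbauer 1 m = 0"
    \<comment> \<open>The angle is chosen to make this sine equal to
      \<open>sin (pi / 2) = 1\<close>.\<close>
    hence "sin ((real m + 1) * (pi / (2 * (real m + 1)))) = 0"
      by (simp only: sin_gegenbauer_1 [symmetric]) simp
    moreover have "(real m + 1) * (pi / (2 * (real m + 1))) = pi / 2" by (simp add: field_simps)
    ultimately show False by (simp only: sin_pi_half one_neq_zero)
  qed
  moreover have card: "card (f ` {1..m}) = m" using inj by (simp add: card_image)
  ultimately show "rooted_in_unit_interval (gegenbauer 1 m)" "degree (gegenbauer 1 m) = m"
    using rooted_in_unit_intervalI[of "gegenbauer 1 m" "f ` {1..m}"] root degree_gegenbauer_1[of m]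
    by simp_all
qed

lemma gegenbauer_1_uminus: "poly (gegenbauer 1 m) (- x) = (- 1) ^ m * poly (gegenbauer 1 m) x"
  by (induction m rule: induct_nat_012) (simp_all add: gegenbauer_1_rec algebra_simps)

lemma poly_pderiv_uminus:
  fixes p :: "real poly"
  assumes "\<And>x. poly p (- x) = e * poly p x"
  shows "poly (pderiv p) (- x) = - e * poly (pderiv p) x"
proof -
  have "poly (pcompose p [:0, - 1:]) = poly (smult e p)"
    using assms by (simp add: fun_eq_iff poly_pcompose)
  hence "pderiv (pcompose p [:0, - 1:]) = pderiv (smult e p)"
    by (simp add: poly_eq_poly_eq_iff)
  from arg_cong[OF this, of "\<lambda>q. poly q x"] show ?thesis
    by (simp add: pderiv_pcompose pderiv_smult pderiv_pCons poly_pcompose)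
qed

section \<open>The Gegenbauer differential equation\<close>

text \<open>The Gegenbauer differential operator. For parameter \<open>b\<close> and degree
  \<open>m\<close>, the equation has \<open>a = 2 * b + 1\<close> and
  \<open>c = m * (m + 2 * b)\<close>; here \<open>b = n + 1\<close>.\<close>

definition gegenbauer_op :: "real \<Rightarrow> real \<Rightarrow> real poly \<Rightarrow> real poly" where
  "gegenbauer_op a c p =
     [:1, 0, - 1:] * pderiv (pderiv p) - smult a ([:0, 1:] * pderiv p) + smult c p"

lemma pderiv_quadratic_mult: "pderiv ([:1, 0, - 1:] * q) = [:1, 0, - 1:] * pderiv q - [:0, 2:] * q"
  for q :: "real poly"
  by (simp only: pderiv_mult) (simp add: pderiv_pCons)

lemma pderiv_X_mult: "pderiv ([:0, 1:] * q) = [:0, 1:] * pderiv q + q"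
  for q :: "real poly"
  by (simp only: pderiv_mult) (simp add: pderiv_pCons)

lemma poly_gegenbauer_op:
  "poly (gegenbauer_op a c p) x =
     (1 - x\<^sup>2) * poly (pderiv (pderiv p)) x - a * x * poly (pderiv p) x + c * poly p x"
  by (simp add: gegenbauer_op_def algebra_simps power2_eq_square)

lemma gegenbauer_op_smult: "gegenbauer_op a c (smult k p) = smult k (gegenbauer_op a c p)"
  by (simp add: gegenbauer_op_def pderiv_smult smult_add_right smult_diff_right mult.commute
      del: mult_pCons_left)

text \<open>Differentiation contributes \<open>- 2 x p''\<close> from the leading coefficient and
  \<open>- a p'\<close> from the middle term, which explains the shifts to \<open>a + 2\<close> and
  \<open>c - a\<close>.\<close>

lemma gegenbauer_op_pderiv:
  "gegenbauer_op (a + 2) (c - a) (pderiv p) = pderiv (gegenbauer_op a c p)"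
proof -
  have "poly (gegenbauer_op (a + 2) (c - a) (pderiv p)) x = poly (pderiv (gegenbauer_op a c p)) x"
    for x
  proof -
    have "poly (pderiv (gegenbauer_op a c p)) x =
        (1 - x\<^sup>2) * poly (pderiv (pderiv (pderiv p))) x - 2 * x * poly (pderiv (pderiv p)) x
        - a * (x * poly (pderiv (pderiv p)) x + poly (pderiv p) x) + c * poly (pderiv p) x"
      unfolding gegenbauer_op_def pderiv_add pderiv_diff pderiv_smult pderiv_quadratic_mult
        pderiv_X_mult
      by (simp add: algebra_simps power2_eq_square)
    thus ?thesis by (simp add: poly_gegenbauer_op algebra_simps)
  qed
  thus ?thesis by (simp add: poly_eq_poly_eq_iff [symmetric] fun_eq_iff)
qed

text \<open>The two relations need a joint induction: the first one at \<open>Suc m\<close> uses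
  both at \<open>m\<close>, the second one uses the first.\<close>

lemma gegenbauer_1_deriv:
  "(1 - x\<^sup>2) * poly (pderiv (gegenbauer 1 (Suc m))) x =
     (real m + 2) * poly (gegenbauer 1 m) x - (real m + 1) * x * poly (gegenbauer 1 (Suc m)) x"
  "(1 - x\<^sup>2) * poly (pderiv (gegenbauer 1 m)) x =
     (real m + 2) * x * poly (gegenbauer 1 m) x - (real m + 1) * poly (gegenbauer 1 (Suc m)) x"
proof (induction m)
  case 0
  show "(1 - x\<^sup>2) * poly (pderiv (gegenbauer 1 (Suc 0))) x =
     (real 0 + 2) * poly (gegenbauer 1 0) x - (real 0 + 1) * x * poly (gegenbauer 1 (Suc 0)) x"
    "(1 - x\<^sup>2) * poly (pderiv (gegenbauer 1 0)) x =
     (real 0 + 2) * x * poly (gegenbauer 1 0) x - (real 0 + 1) * poly (gegenbauer 1 (Suc 0)) x"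
    by (simp_all add: gegenbauer_1_rec pderiv_pCons algebra_simps power2_eq_square)
next
  case (Suc m)
  define u v u' v' where "u = poly (gegenbauer 1 m) x" and "v = poly (gegenbauer 1 (Suc m)) x"
    and "u' = poly (pderiv (gegenbauer 1 m)) x" and "v' = poly (pderiv (gegenbauer 1 (Suc m))) x"
  have w: "poly (gegenbauer 1 (Suc (Suc m))) x = 2 * x * v - u"
    by (simp add: gegenbauer_1_rec(3) u_def v_def)
  have w': "poly (pderiv (gegenbauer 1 (Suc (Suc m)))) x = 2 * v + 2 * x * v' - u'"
    by (simp add: gegenbauer_1_rec(3) u'_def v'_def v_def pderiv_diff pderiv_mult pderiv_pCons
        pderiv_smult pderiv_add)
  have IH: "(1 - x\<^sup>2) * v' = (real m + 2) * u - (real m + 1) * x * v"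
    "(1 - x\<^sup>2) * u' = (real m + 2) * x * u - (real m + 1) * v"
    using Suc by (simp_all add: u_def v_def u'_def v'_def)
  have "(1 - x\<^sup>2) * (2 * v + 2 * x * v' - u') =
      2 * (1 - x\<^sup>2) * v + 2 * x * ((1 - x\<^sup>2) * v') - (1 - x\<^sup>2) * u'"
    by algebra
  thus "(1 - x\<^sup>2) * poly (pderiv (gegenbauer 1 (Suc (Suc m)))) x =
      (real (Suc m) + 2) * poly (gegenbauer 1 (Suc m)) x -
      (real (Suc m) + 1) * x * poly (gegenbauer 1 (Suc (Suc m))) x"
    unfolding w w' IH v_def [symmetric] by (simp add: algebra_simps power2_eq_square)
  show "(1 - x\<^sup>2) * poly (pderiv (gegenbauer 1 (Suc m))) x =
      (real (Suc m) + 2) * x * poly (gegenbauer 1 (Suc m)) x -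
      (real (Suc m) + 1) * poly (gegenbauer 1 (Suc (Suc m))) x"
    unfolding w IH v_def [symmetric] v'_def [symmetric] by (simp add: algebra_simps)
qed

text \<open>Differentiating the second relation of \<open>gegenbauer_1_deriv\<close> brings in the
  derivative of \<open>?V\<close>, which the first relation eliminates after multiplication by
  \<open>1 - x\<^sup>2\<close>. This factor is cancelled at the end in the polynomial ring, so the
  points 1 and -1 are covered.\<close>

lemma gegenbauer_op_gegenbauer_1:
  "gegenbauer_op 3 (real m * (real m + 2)) (gegenbauer 1 m) = 0"
proof -
  let ?U = "gegenbauer 1 m" and ?V = "gegenbauer 1 (Suc m)"
  let ?E = "gegenbauer_op 3 (real m * (real m + 2)) ?U"
  have "poly ([:1, 0, - 1:] * pderiv ?U) =
      poly (smult (real m + 2) ([:0, 1:] * ?U) - smult (real m + 1) ?V)"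
    using gegenbauer_1_deriv(2)[of _ m]
    by (simp add: fun_eq_iff algebra_simps power2_eq_square)
  hence "[:1, 0, - 1:] * pderiv ?U = smult (real m + 2) ([:0, 1:] * ?U) - smult (real m + 1) ?V"
    by (simp only: poly_eq_poly_eq_iff)
  hence eq: "pderiv ([:1, 0, - 1:] * pderiv ?U) =
      pderiv (smult (real m + 2) ([:0, 1:] * ?U) - smult (real m + 1) ?V)"
    by simp
  have "poly ([:1, 0, - 1:] * ?E) = poly 0"
  proof
    fix x
    define u v u' v' u'' where "u = poly ?U x" and "v = poly ?V x" and "u' = poly (pderiv ?U) x"
      and "v' = poly (pderiv ?V) x" and "u'' = poly (pderiv (pderiv ?U)) x"
    have 1: "(1 - x\<^sup>2) * v' = (real m + 2) * u - (real m + 1) * x * v"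
      "(1 - x\<^sup>2) * u' = (real m + 2) * x * u - (real m + 1) * v"
      using gegenbauer_1_deriv[of x m] by (simp_all add: u_def v_def u'_def v'_def)
    have "(1 - x\<^sup>2) * u'' - 2 * x * u' = (real m + 2) * (x * u' + u) - (real m + 1) * v'"
      using arg_cong[OF eq, of "\<lambda>q. poly q x"]
      unfolding pderiv_quadratic_mult pderiv_diff pderiv_smult pderiv_X_mult
      by (simp add: u_def u'_def v'_def u''_def algebra_simps power2_eq_square)
    with 1 have "(1 - x\<^sup>2) * ((1 - x\<^sup>2) * u'' - 3 * x * u' + real m * (real m + 2) * u) = 0"
      by algebra
    moreover have "poly ?E x = (1 - x\<^sup>2) * u'' - 3 * x * u' + real m * (real m + 2) * u"
      by (simp add: poly_gegenbauer_op u_def u'_def u''_def)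
    ultimately show "poly ([:1, 0, - 1:] * ?E) x = poly 0 x"
      by (simp del: mult_pCons_left add: power2_eq_square)
  qed
  hence "[:1, 0, - 1:] * ?E = 0" by (simp only: poly_eq_poly_eq_iff)
  thus ?thesis by (metis mult_eq_0_iff pCons_eq_0_iff zero_neq_one)
qed

text \<open>Induction on \<open>n\<close> for all degrees at once: up to a nonzero constant, the
  polynomial for \<open>Suc n\<close> and \<open>d\<close> is the derivative of the one for
  \<open>n\<close> and \<open>Suc d\<close>, and differentiation transports each property.\<close>

lemma gegenbauer_roots_parity_ode:
  fixes n d :: nat
  defines "p \<equiv> gegenbauer (real n + 1) d"
  shows "rooted_in_unit_interval p" "degree p = d" "poly p (- x) = (- 1) ^ d * poly p x"
    "gegenbauer_op (2 * real n + 3) (real d * (real d + 2 * real n + 2)) p = 0"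
proof -
  let ?p = "\<lambda>n d. gegenbauer (real n + 1) d"
  have "rooted_in_unit_interval (?p n d) \<and> degree (?p n d) = d \<and>
      (\<forall>x. poly (?p n d) (- x) = (- 1) ^ d * poly (?p n d) x) \<and>
      gegenbauer_op (2 * real n + 3) (real d * (real d + 2 * real n + 2)) (?p n d) = 0"
  proof (induction n arbitrary: d)
    case 0
    show ?case
      using gegenbauer_op_gegenbauer_1[of d]
      by (simp add: gegenbauer_1_roots gegenbauer_1_uminus)
  next
    case (Suc n)
    let ?q = "pderiv (?p n (Suc d))"
    have q: "?q = smult (2 * (real n + 1)) (?p (Suc n) d)"
      by (simp add: pderiv_gegenbauer algebra_simps)
    hence p: "?p (Suc n) d = smult (inverse (2 * (real n + 1))) ?q"
      by simp
    have "real (Suc d) * (real (Suc d) + 2 * real n + 2) - (2 * real n + 3) =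
        real d * (real d + 2 * real (Suc n) + 2)"
      by (simp add: algebra_simps)
    hence "gegenbauer_op (2 * real (Suc n) + 3) (real d * (real d + 2 * real (Suc n) + 2)) ?q =
        pderiv (gegenbauer_op (2 * real n + 3) (real (Suc d) * (real (Suc d) + 2 * real n + 2))
          (?p n (Suc d)))"
      by (simp add: gegenbauer_op_pderiv [symmetric] algebra_simps)
    hence op: "gegenbauer_op (2 * real (Suc n) + 3) (real d * (real d + 2 * real (Suc n) + 2)) ?q = 0"
      using Suc.IH[of "Suc d"] by simp
    have "rooted_in_unit_interval ?q" "degree ?q = d"
      using Suc.IH[of "Suc d"] by (auto intro!: rooted_in_unit_interval_pderiv simp: degree_pderiv)
    moreover have "poly ?q (- x) = (- 1) ^ d * poly ?q x" for x
      using Suc.IH[of "Suc d"] poly_pderiv_uminus[of "?p n (Suc d)" "(- 1) ^ Suc d" x] by simp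
    ultimately show ?case
      unfolding p using op
      by (simp add: rooted_in_unit_interval_def gegenbauer_op_smult del: of_nat_Suc)
  qed
  thus "rooted_in_unit_interval p" "degree p = d" "poly p (- x) = (- 1) ^ d * poly p x"
    "gegenbauer_op (2 * real n + 3) (real d * (real d + 2 * real n + 2)) p = 0"
    by (simp_all add: p_def)
qed

section \<open>Sign of \<open>f\<close> at the Cauchy transform to the right of the roots\<close>

text \<open>A single summand can be positive, for instance for negative \<open>r\<close> and large
  \<open>x\<close>; only the sum over \<open>r\<close> and \<open>- r\<close> has a definite
  sign.\<close>

lemma symmetric_sum_neg:
  fixes x :: real
  assumes "finite R" "R \<noteq> {}" "\<And>r. r \<in> R \<Longrightarrow> - r \<in> R" "\<And>r. r \<in> R \<Longrightarrow> \<bar>r\<bar> < 1"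
    and "\<And>r. r \<in> R \<Longrightarrow> r < x"
  shows "(x\<^sup>2 - 1) * (\<Sum>r\<in>R. 1 / (x - r)\<^sup>2) - 3 * x * (\<Sum>r\<in>R. 1 / (x - r)) + 2 * real (card R) < 0"
proof -
  define \<phi> where "\<phi> = (\<lambda>r. (x\<^sup>2 - 1) * (1 / (x - r)\<^sup>2) - 3 * x * (1 / (x - r)) + 2)"
  have sum: "(\<Sum>r\<in>R. \<phi> r) =
      (x\<^sup>2 - 1) * (\<Sum>r\<in>R. 1 / (x - r)\<^sup>2) - 3 * x * (\<Sum>r\<in>R. 1 / (x - r)) + 2 * real (card R)"
    unfolding \<phi>_def sum.distrib sum_subtractf sum_distrib_left by simp
  have "(\<Sum>r\<in>R. \<phi> (- r)) = (\<Sum>r\<in>R. \<phi> r)"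
    using assms(3) by (intro sum.reindex_bij_witness[of _ uminus uminus]) auto
  hence "2 * (\<Sum>r\<in>R. \<phi> r) = (\<Sum>r\<in>R. \<phi> r + \<phi> (- r))"
    by (simp add: sum.distrib)
  also have "\<dots> < 0"
  proof -
    have "\<phi> r + \<phi> (- r) < 0" if r: "r \<in> R" for r
    proof -
      define u v where "u = 1 / (x - r)" and "v = 1 / (x + r)"
      have pos: "x - r > 0" "x + r > 0" using assms(3,5) r by fastforce+
      have uv: "(x - r) * u = 1" "(x + r) * v = 1" and uv0: "u > 0" "v > 0"
        using pos by (auto simp: u_def v_def)
      have "\<phi> r + \<phi> (- r) = (x\<^sup>2 - 1) * (u\<^sup>2 + v\<^sup>2) - 3 * x * (u + v) + 4"
        by (simp add: \<phi>_def u_def v_def power_one_over algebra_simps)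
      \<comment> \<open>By \<open>u + v = 2 * x * (u * v)\<close> and
        \<open>1 = (x\<^sup>2 - r\<^sup>2) * (u * v)\<close>, every term acquires the factor
        \<open>(u * v)\<^sup>2\<close>, and the terms in \<open>x ^ 4\<close> and
        \<open>x\<^sup>2 * r\<^sup>2\<close> cancel.\<close>
      also have "\<dots> = - 2 * (x\<^sup>2 + r\<^sup>2 - 2 * (r\<^sup>2)\<^sup>2) * (u * v)\<^sup>2"
        using uv by algebra
      also have "\<dots> < 0"
      proof -
        have "r\<^sup>2 < 1" using assms(4)[OF r] by (simp add: abs_square_less_1)
        hence "(r\<^sup>2)\<^sup>2 \<le> r\<^sup>2" by (simp add: power2_eq_square mult_left_le)
        moreover have "(x - r) * (x + r) > 0" using pos by simp
        hence "r\<^sup>2 < x\<^sup>2" by (simp add: algebra_simps power2_eq_square)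
        ultimately have "x\<^sup>2 + r\<^sup>2 - 2 * (r\<^sup>2)\<^sup>2 > 0" by linarith
        moreover have "(u * v)\<^sup>2 > 0" using uv0 by simp
        ultimately show ?thesis by (intro mult_neg_pos) simp_all
      qed
      finally show ?thesis .
    qed
    thus ?thesis using sum_strict_mono[OF assms(1,2), of "\<lambda>r. \<phi> r + \<phi> (- r)" "\<lambda>_. 0"] by simp
  qed
  finally show ?thesis using sum by simp
qed

lemma bivariate_f_log_deriv_neg:
  fixes R :: "real set" and n :: nat and x :: real
  defines "p \<equiv> \<Prod>r\<in>R. [:- r, 1:]" and "d \<equiv> card R"
  assumes "finite R" "R \<noteq> {}" "\<And>r. r \<in> R \<Longrightarrow> - r \<in> R" "\<And>r. r \<in> R \<Longrightarrow> \<bar>r\<bar> < 1"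
    and x: "\<And>r. r \<in> R \<Longrightarrow> r < x"
    and op: "gegenbauer_op (2 * real n + 3) (real d * (real d + 2 * real n + 2)) p = 0"
  shows "bivariate_f n d x ((\<Sum>r\<in>R. 1 / (x - r)) / real d) < 0"
proof -
  define S Q where "S = (\<Sum>r\<in>R. 1 / (x - r))" and "Q = (\<Sum>r\<in>R. 1 / (x - r)\<^sup>2)"
  have d: "real d > 0" using assms by (simp add: card_gt_0_iff)
  have "x \<notin> R" using x by auto
  hence p': "poly (pderiv p) x = poly p x * S" "poly (pderiv (pderiv p)) x = poly p x * (S\<^sup>2 - Q)"
    using prod_linear_derivs[OF \<open>finite R\<close>] by (simp_all add: p_def S_def Q_def)
  have p: "poly p x \<noteq> 0" using \<open>x \<notin> R\<close> \<open>finite R\<close> by (auto simp: p_def poly_prod)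
  have "poly p x * ((1 - x\<^sup>2) * (S\<^sup>2 - Q) - (2 * real n + 3) * x * S
      + real d * (real d + 2 * real n + 2)) = 0"
    using arg_cong[OF op, of "\<lambda>q. poly q x"] by (simp add: poly_gegenbauer_op p' algebra_simps)
  with p have ode: "(1 - x\<^sup>2) * (S\<^sup>2 - Q) - (2 * real n + 3) * x * S
      + real d * (real d + 2 * real n + 2) = 0"
    by simp
  have "real d * bivariate_f n d x (S / real d) =
      (x\<^sup>2 - 1) * S\<^sup>2 + 2 * real n * x * S - real d * (2 * real n + real d)"
    using d by (simp add: bivariate_f_def field_simps power2_eq_square)
  \<comment> \<open>The differential equation replaces the term in \<open>S\<^sup>2\<close>, and
    everything involving \<open>n\<close> cancels.\<close>
  also have "\<dots> = (x\<^sup>2 - 1) * Q - 3 * x * S + 2 * real d"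
    using ode by (simp add: algebra_simps)
  also have "\<dots> < 0"
    unfolding Q_def S_def d_def by (rule symmetric_sum_neg) (use assms in auto)
  finally show ?thesis using d by (simp add: S_def mult_less_0_iff)
qed

section \<open>Position relative to the vertex of the parabola\<close>

text \<open>If \<open>t < g\<close>, the chord of \<open>f(x, -)\<close> from \<open>t\<close> to
  \<open>g\<close> has nonnegative slope: for \<open>x < 1\<close> both points are at most the
  vertex, and for \<open>x \<ge> 1\<close> the function is nondecreasing in \<open>y > 0\<close>.
  This contradicts the signs at \<open>g\<close> and \<open>t\<close>.\<close>

lemma bivariate_f_nonneg_imp_ge:
  assumes neg: "bivariate_f n d x g < 0" and nonneg: "bivariate_f n d x t \<ge> 0"
    and "t > 0" "x \<ge> 0"
    and vertex: "x < 1 \<Longrightarrow> real d * (1 - x\<^sup>2) * g \<le> real n * x"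
  shows "g \<le> t"
proof (rule ccontr)
  assume "\<not> g \<le> t"
  hence lt: "t < g" by simp
  have diff: "bivariate_f n d x g - bivariate_f n d x t =
      (g - t) * (real d * (x\<^sup>2 - 1) * (g + t) + 2 * real n * x)"
    by (simp add: bivariate_f_def algebra_simps power2_eq_square)
  have "real d * (x\<^sup>2 - 1) * (g + t) + 2 * real n * x \<ge> 0"
  proof (cases "x < 1")
    case False
    thus ?thesis using lt assms by (intro add_nonneg_nonneg mult_nonneg_nonneg) auto
  next
    case True
    have "x\<^sup>2 \<le> 1" using True \<open>x \<ge> 0\<close> by (simp add: abs_square_le_1)
    hence "real d * (1 - x\<^sup>2) * t \<le> real d * (1 - x\<^sup>2) * g"
      using lt by (intro mult_left_mono) auto
    thus ?thesis using vertex[OF True] by (simp add: algebra_simps)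
  qed
  hence "bivariate_f n d x g - bivariate_f n d x t \<ge> 0"
    unfolding diff using lt by simp
  thus False using neg nonneg by simp
qed

lemma roots_less_and_below_vertex:
  fixes R :: "real set" and n :: nat and s :: real
  defines "p \<equiv> \<Prod>r\<in>R. [:- r, 1:]" and "d \<equiv> card R"
  assumes R: "finite R" "R \<noteq> {}" "\<And>r. r \<in> R \<Longrightarrow> \<bar>r\<bar> < 1"
    and neg: "\<And>x. (\<And>r. r \<in> R \<Longrightarrow> r < x) \<Longrightarrow>
                bivariate_f n d x ((\<Sum>r\<in>R. 1 / (x - r)) / real d) < 0"
    and s: "s > gamma_ratio n d" "s < 1"
  shows "(\<forall>r\<in>R. r < s) \<and> (1 - s\<^sup>2) * (\<Sum>r\<in>R. 1 / (s - r)) \<le> real n * s"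
proof -
  define S where "S = (\<lambda>x. \<Sum>r\<in>R. 1 / (x - r))"
  define m where "m = Max R"
  have m: "m \<in> R" "\<And>r. r \<in> R \<Longrightarrow> r \<le> m" using R by (auto simp: m_def)
  hence m1: "m < 1" using R(3) by fastforce
  have d: "d > 0" using R by (simp add: d_def card_gt_0_iff)
  have frac: "real n ^ 2 / (real n + real d) ^ 2 \<le> 1"
    using d by (simp add: power_mono)
  hence "gamma_ratio n d \<ge> 0" by (simp add: gamma_ratio_def)
  hence s0: "s > 0" using s by simp
  \<comment> \<open>The condition \<open>x > gamma_ratio n d\<close>, squared and cleared of
    denominators; it makes \<open>f(x, -)\<close> positive at its vertex when
    \<open>x < 1\<close>.\<close>
  have disc: "real d * (2 * real n + real d) < (real n + real d)\<^sup>2 * x\<^sup>2" if "x \<ge> s" for x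
  proof -
    have "gamma_ratio n d < x" using s that by simp
    hence "(gamma_ratio n d)\<^sup>2 < x\<^sup>2"
      using \<open>gamma_ratio n d \<ge> 0\<close> by (intro power_strict_mono) auto
    hence "1 - real n ^ 2 / (real n + real d) ^ 2 < x\<^sup>2"
      using frac by (simp add: gamma_ratio_def)
    hence "(real n + real d)\<^sup>2 * (1 - real n ^ 2 / (real n + real d) ^ 2) < (real n + real d)\<^sup>2 * x\<^sup>2"
      using d by (intro mult_strict_left_mono) auto
    moreover have "(real n + real d)\<^sup>2 * (1 - real n ^ 2 / (real n + real d) ^ 2) =
        (real n + real d)\<^sup>2 - real n ^ 2"
      using d by (simp add: right_diff_distrib)
    ultimately show ?thesis by (simp add: power2_eq_square algebra_simps)
  qed
  \<comment> \<open>For \<open>n = 0\<close> the lower bound on \<open>s\<close> is 1, which leaves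
    no \<open>s < 1\<close>. Positivity of \<open>n\<close> gives \<open>poly H 1 > 0\<close>
    below.\<close>
  have n: "real n > 0"
  proof (rule ccontr)
    assume "\<not> real n > 0"
    hence "gamma_ratio n d = 1" by (simp add: gamma_ratio_def)
    thus False using s by simp
  qed
  have p_pos: "poly p x > 0" if "x > m" for x
    unfolding p_def poly_prod using that m(2) by (intro prod_pos) fastforce
  have p': "poly (pderiv p) x = poly p x * S x" if "x > m" for x
    unfolding p_def S_def using that m(2) R(1) by (intro prod_linear_derivs) fastforce+
  \<comment> \<open>To the right of \<open>m\<close>,
    \<open>H / p = n x - (1 - x\<^sup>2) S\<close>, so the sign of \<open>H\<close> tells on which
    side of the vertex \<open>S / d\<close> lies. Being a polynomial, \<open>H\<close> also makes
    sense at \<open>m\<close>, where \<open>S\<close> has a pole.\<close>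
  define H where "H = [:0, real n:] * p - [:1, 0, - 1:] * pderiv p"
  have H: "poly H x = real n * x * poly p x - (1 - x\<^sup>2) * poly (pderiv p) x" for x
    by (simp add: H_def algebra_simps power2_eq_square)
  have Hm: "poly H m < 0"
  proof -
    define q where "q = (\<Prod>r\<in>R - {m}. [:- r, 1:])"
    have p: "p = [:- m, 1:] * q"
      unfolding p_def q_def using R(1) m(1) by (rule prod.remove)
    have "poly (pderiv p) m = poly q m"
      unfolding p pderiv_mult by (simp add: pderiv_pCons)
    also have "\<dots> > 0"
      unfolding q_def poly_prod using m(2) by (intro prod_pos) (fastforce simp: less_le)
    finally have "(1 - m\<^sup>2) * poly (pderiv p) m > 0"
      using R(3)[OF m(1)] by (simp add: abs_square_less_1)
    moreover have "poly p m = 0" unfolding p by simp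
    ultimately show ?thesis by (simp add: H)
  qed
  have H_pos: "poly H w > 0" if w: "s \<le> w" "m \<le> w" "w < 1" for w
  proof (rule ccontr)
    assume "\<not> poly H w > 0"
    moreover have H1: "poly H 1 > 0" using n p_pos m1 by (simp add: H)
    \<comment> \<open>A zero \<open>z\<close> of \<open>H\<close> between \<open>w\<close> and 1
      would put \<open>S z / d\<close> exactly at the vertex, where \<open>f\<close> is positive by
      \<open>disc\<close> but negative by \<open>neg\<close>.\<close>
    ultimately obtain z where z: "w \<le> z" "z \<le> 1" "poly H z = 0"
      using IVT'[of "poly H" w 0 1] w by (auto simp: continuous_on_poly)
    have "z \<noteq> m" "z \<noteq> 1" using Hm H1 z by auto
    hence z': "m < z" "z < 1" "s \<le> z" using z w by auto
    have "poly p z * (real n * z - (1 - z\<^sup>2) * S z) = 0"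
      using z(3) by (simp add: H p'[OF z'(1)] algebra_simps)
    hence S: "(1 - z\<^sup>2) * S z = real n * z" using p_pos[OF z'(1)] by simp
    have z2: "1 - z\<^sup>2 > 0" using z' s0 by (simp add: abs_square_less_1)
    have "real d * bivariate_f n d z (S z / real d) =
        - ((1 - z\<^sup>2) * S z) * S z + 2 * real n * z * S z - real d * (2 * real n + real d)"
      using d by (simp add: bivariate_f_def field_simps power2_eq_square)
    also have "\<dots> = real n * z * S z - real d * (2 * real n + real d)"
      by (simp add: S)
    finally have f: "real d * bivariate_f n d z (S z / real d) =
      real n * z * S z - real d * (2 * real n + real d)" .
    have "(1 - z\<^sup>2) * (real d * bivariate_f n d z (S z / real d)) =
        real n * z * ((1 - z\<^sup>2) * S z) - (1 - z\<^sup>2) * (real d * (2 * real n + real d))"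
      unfolding f by (simp add: algebra_simps)
    also have "\<dots> = (real n + real d)\<^sup>2 * z\<^sup>2 - real d * (2 * real n + real d)"
      unfolding S by (simp add: algebra_simps power2_eq_square)
    also have "\<dots> > 0" using disc[OF z'(3)] by simp
    finally have "bivariate_f n d z (S z / real d) > 0"
      using z2 d by (simp add: zero_less_mult_iff)
    moreover have "bivariate_f n d z (S z / real d) < 0"
      unfolding S_def by (rule neg) (use m(2) z' in fastforce)
    ultimately show False by simp
  qed
  \<comment> \<open>Otherwise \<open>H_pos\<close> would apply at \<open>w = m\<close>, against
    \<open>Hm\<close>.\<close>
  have ms: "m < s"
  proof (rule ccontr)
    assume "\<not> m < s"
    hence "poly H m > 0" using m1 by (intro H_pos) auto
    thus False using Hm by simp
  qed
  have "poly p s * (real n * s - (1 - s\<^sup>2) * S s) > 0"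
    using H_pos[of s] ms s by (simp add: H p' algebra_simps)
  hence "(1 - s\<^sup>2) * S s \<le> real n * s"
    using p_pos[OF ms] by (simp add: zero_less_mult_iff)
  thus ?thesis using m(2) ms by (fastforce simp: S_def)
qed

text \<open>The nonvanishing of the denominator is asserted too: division by zero yields 0, so at a
  root the bound alone would hold trivially.\<close>

theorem theorem6p11:
  fixes n d :: nat and s t :: real
  assumes "d \<ge> 1"
    and "s > gamma_ratio n d"
    and "t > 0"
    and "bivariate_f n d s t \<ge> 0"
  shows "poly (gegenbauer (real n + 1) d) s \<noteq> 0 \<and>
         cauchy_transform (gegenbauer (real n + 1) d) s \<le> t"
proof -
  define C where "C = gegenbauer (real n + 1) d"
  define R where "R = {x. \<bar>x\<bar> < 1 \<and> poly C x = 0}"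
  define p where "p = (\<Prod>r\<in>R. [:- r, 1:])"
  define S where "S = (\<lambda>x. \<Sum>r\<in>R. 1 / (x - r))"
  note C = gegenbauer_roots_parity_ode[of n d, folded C_def]
  have "C \<noteq> 0" and card: "card R = d"
    using C(1,2) by (auto simp: rooted_in_unit_interval_def R_def)
  have R: "finite R" "R \<noteq> {}" "\<And>r. r \<in> R \<Longrightarrow> - r \<in> R" "\<And>r. r \<in> R \<Longrightarrow> \<bar>r\<bar> < 1"
  proof -
    show "finite R" "R \<noteq> {}" using card \<open>d \<ge> 1\<close> by (auto intro: card_ge_0_finite)
  qed (auto simp: R_def C(3))
  have Cp: "C = smult (lead_coeff C) p"
    unfolding p_def using R(1) card C(2)
    by (intro poly_eq_smult_prod_roots) (auto simp: R_def)
  hence eqs: "poly C x = lead_coeff C * poly p x"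
    "poly (pderiv C) x = lead_coeff C * poly (pderiv p) x" for x
    by (metis poly_smult, metis poly_smult pderiv_smult)
  have lc: "lead_coeff C \<noteq> 0" using \<open>C \<noteq> 0\<close> by simp
  have "smult (lead_coeff C)
      (gegenbauer_op (2 * real n + 3) (real d * (real d + 2 * real n + 2)) p) = 0"
    using C(4) by (subst gegenbauer_op_smult [symmetric], subst Cp [symmetric])
  hence op: "gegenbauer_op (2 * real n + 3) (real d * (real d + 2 * real n + 2)) p = 0"
    using lc unfolding smult_eq_0_iff by blast
  have neg: "bivariate_f n d x (S x / real d) < 0" if "\<And>r. r \<in> R \<Longrightarrow> r < x" for x
    using bivariate_f_log_deriv_neg[OF R that] op card by (simp add: S_def p_def)
  have below: "(\<forall>r\<in>R. r < s) \<and> (1 - s\<^sup>2) * S s \<le> real n * s" if "s < 1"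
    using roots_less_and_below_vertex[OF R(1,2,4), of n s] neg that assms(2) card
    by (simp add: S_def)
  have Rs: "r < s" if "r \<in> R" for r
    using R(4)[OF that] that below by (cases "s < 1") auto
  hence "s \<notin> R" by auto
  hence p: "poly p s \<noteq> 0" "poly (pderiv p) s = poly p s * S s"
    using R(1) prod_linear_derivs(1)[of R s] by (auto simp: p_def S_def poly_prod)
  have "cauchy_transform C s = S s / real d"
    using p lc by (simp add: cauchy_transform_def C(2) eqs)
  moreover have "S s / real d \<le> t"
  proof (rule bivariate_f_nonneg_imp_ge[OF neg assms(4,3)])
    obtain r where "r \<in> R" using R(2) by auto
    \<comment> \<open>Both \<open>r\<close> and \<open>- r\<close> lie below \<open>s\<close>, hence
      so does 0.\<close>
    thus "s \<ge> 0" using Rs[of r] Rs[of "- r"] R(3) by fastforce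
    show "real d * (1 - s\<^sup>2) * (S s / real d) \<le> real n * s" if "s < 1"
      using below[OF that] \<open>d \<ge> 1\<close> by simp
  qed (fact Rs)
  ultimately show ?thesis
    using p lc by (simp add: eqs flip: C_def)
qed

end
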